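(* Let $f:\mathbb{R}\to\mathbb{R}$, $f(x)=\cos(x)$. If $\langle i,\delta\mathbb{R}\rangle$ is either the Alexandroff one-point compactification of $\mathbb{R}$ or the two-point compactification $[-\infty,\infty]$ of $\mathbb{R}$, then there is no continuous function $\tilde f:\delta\mathbb{R}\to\mathbb{R}$ such that $\tilde f\circ i=f$.
   Context: The one-point compactification of $\mathbb{R}$ is $\mathbb{R}\cup\{\infty\}$ with the Alexandroff topology, with $i$ the inclusion. The two-point compactification is the extended real line $[-\infty,\infty]$ with its order topology, with $i$ the inclusion. *)

theory Defs
  imports "HOL-Analysis.Analysis"
begin

end

theory Submission
  imports Defs
begin

text \<open>In both compactifications the included reals converge at \<open>at_top\<close> to an
  added point \<open>l\<close>, so a continuous \<open>g\<close> extending cosine would give cosine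
  the limit \<open>g l\<close>. This contradicts \<open>cos_no_limit_at_top\<close>: translates of
  cosine would share that limit, which is incompatible with the Pythagorean identity.\<close>

text \<open>In either compactification the inclusion of the reals converges as its argument tends to
  positive infinity, so a continuous extension would give the cosine a limit there.\<close>

lemma cos_no_limit_at_top: "\<not> (cos \<longlongrightarrow> L) (at_top :: real filter)"
proof
  assume lim: "(cos \<longlongrightarrow> L) (at_top :: real filter)"
  have shift: "((\<lambda>x. cos (a + x)) \<longlongrightarrow> L) at_top" for a :: real
    by (intro filterlim_compose[OF lim] filterlim_tendsto_add_at_top[OF tendsto_const] filterlim_ident)
  \<comment> \<open>A shift by half a period changes the sign of cosine, which forces
    \<open>L\<close> to vanish.\<close>
  have "((\<lambda>x::real. - cos x) \<longlongrightarrow> L) at_top"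
    using shift[of pi] by (simp add: cos_add)
  then have "L = - L"
    using tendsto_minus[OF lim] by (rule tendsto_unique[OF trivial_limit_at_top_linorder])
  then have "L\<^sup>2 = 0"
    by simp
  \<comment> \<open>A quarter-period shift turns cosine into sine, so both squares tend to the
    square of \<open>L\<close> although their sum is constantly 1.\<close>
  have "(sin \<longlongrightarrow> L) (at_top :: real filter)"
    using shift[of "- (pi / 2)"] by (simp add: cos_diff)
  then have "((\<lambda>x::real. (sin x)\<^sup>2 + (cos x)\<^sup>2) \<longlongrightarrow> L\<^sup>2 + L\<^sup>2) at_top"
    by (intro tendsto_intros lim)
  then have "L\<^sup>2 + L\<^sup>2 = 1"
    by (simp add: tendsto_const_iff)
  with \<open>L\<^sup>2 = 0\<close> show False by simp
qed

text \<open>An open set around \<open>None\<close> omits only a compact set of reals; that set is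
  bounded above, so some ray towards positive infinity avoids it.\<close>

lemma limitin_Some_Alexandroff_compactification_at_top:
  "limitin (Alexandroff_compactification (euclidean :: real topology)) Some None at_top"
  unfolding limitin_def
proof (intro conjI allI impI)
  show "None \<in> topspace (Alexandroff_compactification (euclidean :: real topology))"
    by simp
next
  fix U
  assume "openin (Alexandroff_compactification (euclidean :: real topology)) U \<and> None \<in> U"
  then obtain C :: "real set" where "compact C" and U: "U = insert None (Some ` (- C))"
    by (auto simp: openin_Alexandroff_compactification Compl_eq_Diff_UNIV)
  then obtain B where "\<And>x. x \<in> C \<Longrightarrow> x \<le> B"
    by (meson bounded_has_Sup(1) compact_imp_bounded empty_iff bdd_above_def bounded_imp_bdd_above)
  then show "\<forall>\<^sub>F x in at_top. Some x \<in> U"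
    unfolding U by (intro eventually_mono[OF eventually_gt_at_top[of B]]) force
qed

theorem proposition3p1:
  fixes f :: "real \<Rightarrow> real"
  assumes "\<And>x. f x = cos x"
  shows "(\<nexists>g :: real option \<Rightarrow> real.
            continuous_map (Alexandroff_compactification (euclidean :: real topology)) euclidean g \<and>
            g \<circ> Some = f) \<and>
         (\<nexists>g :: ereal \<Rightarrow> real.
            continuous_map (euclidean :: ereal topology) euclidean g \<and>
            g \<circ> ereal = f)"
proof -
  \<comment> \<open>Keeping \<open>X\<close>, \<open>i\<close> and \<open>l\<close> arbitrary lets
    one argument serve both cases, with \<open>l\<close> being \<open>None\<close> or
    \<open>\<infinity>\<close>.\<close>
  have no_ext: False
    if "limitin X i l at_top" and "continuous_map X euclidean g" and "g \<circ> i = f"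
    for X :: "'b topology" and i l g
  proof -
    have "f = cos"
      using assms by blast
    with continuous_map_limit[OF that(2,1)] that(3) have "(cos \<longlongrightarrow> g l) at_top"
      by simp
    then show False
      using cos_no_limit_at_top by blast
  qed
  have "limitin euclidean ereal \<infinity> at_top"
    by (simp add: tendsto_PInfty eventually_gt_at_top)
  show ?thesis
    using no_ext[OF limitin_Some_Alexandroff_compactification_at_top]
      no_ext[OF \<open>limitin euclidean ereal \<infinity> at_top\<close>] by blast
qed

end
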